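(* Let $(X,R)$ be a forcing network that is acyclic, i.e. the directed graph with vertex set $X$ and an arc $a\to b$ for each rule $a\to b\in R$ has no directed cycle. Then for every $X$-colored graph $G$, the multi-color forcing process without propagation, applying $(X,R)$ to $G$, terminates.
   Context: Let $X\subseteq\{1,\dots,N\}$ be a finite set of colors. An $X$-colored graph is a finite simple graph together with an assignment of a color from $X$ to each vertex. A forcing network is a pair $(X,R)$ where $R=(r_1,\dots,r_m)$ is an ordered list of color change rules, each of the form $a\to b$ with $a,b\in X$, $a\ne b$. A forcing step with rule $a\to b$ means: simultaneously recolor with color $a$ every vertex of color $b$ that has at least one neighbor of color $a$. In the multi-color forcing process without propagation, single forcing steps are performed with the rules in the cyclic order $r_1,\dots,r_m,r_1,\dots,r_m,\dots$ (one forcing step per rule). The process terminates if it reaches a coloring in which no rule can be applied, i.e. for no $a\to b\in R$ is there an edge joining a vertex of color $a$ to a vertex of color $b$. *)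

theory Defs
  imports "Graph_Theory.Graph_Theory"
begin

type_synonym color = nat

text \<open>The rule \<open>a \<rightarrow> b\<close> is the pair \<open>(a, b)\<close>: color \<open>a\<close> overwrites color \<open>b\<close>.\<close>
type_synonym rule = "color \<times> color"

definition forcing_network :: "nat \<Rightarrow> color set \<Rightarrow> rule list \<Rightarrow> bool" where
  "forcing_network N X R \<longleftrightarrow>
     X \<subseteq> {1..N} \<and> (\<forall>(a, b) \<in> set R. a \<in> X \<and> b \<in> X \<and> a \<noteq> b)"

definition network_digraph :: "color set \<Rightarrow> rule list \<Rightarrow> color pair_pre_digraph" where
  "network_digraph X R = \<lparr>pverts = X, parcs = set R\<rparr>"

definition acyclic_network :: "color set \<Rightarrow> rule list \<Rightarrow> bool" where
  "acyclic_network X R \<longleftrightarrow>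
     \<not> (\<exists>p. pre_digraph.cycle (with_proj (network_digraph X R)) p)"

text \<open>A finite simple graph is a \<open>pair_graph\<close> (finite, loopless, symmetric, arcs are pairs of
  vertices). A coloring is a total function of which only the values on vertices matter.\<close>
definition colored_graph :: "color set \<Rightarrow> 'v pair_pre_digraph \<Rightarrow> ('v \<Rightarrow> color) \<Rightarrow> bool" where
  "colored_graph X G c \<longleftrightarrow> pair_graph G \<and> (\<forall>v \<in> pverts G. c v \<in> X)"

definition forcing_step ::
    "'v pair_pre_digraph \<Rightarrow> rule \<Rightarrow> ('v \<Rightarrow> color) \<Rightarrow> 'v \<Rightarrow> color" where
  "forcing_step G r c = (case r of (a, b) \<Rightarrow>
     (\<lambda>v. if c v = b \<and> (\<exists>u. (u, v) \<in> parcs G \<and> c u = a) then a else c v))"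

text \<open>The coloring after \<open>t\<close> single forcing steps, the rules being used in cyclic order. For the
  empty rule list the value at \<open>t > 0\<close> is unspecified, but there the initial coloring already
  admits no rule.\<close>
primrec forcing_process ::
    "'v pair_pre_digraph \<Rightarrow> rule list \<Rightarrow> ('v \<Rightarrow> color) \<Rightarrow> nat \<Rightarrow> 'v \<Rightarrow> color" where
  "forcing_process G R c 0 = c"
| "forcing_process G R c (Suc t) =
     forcing_step G (R ! (t mod length R)) (forcing_process G R c t)"

definition rule_applicable :: "'v pair_pre_digraph \<Rightarrow> ('v \<Rightarrow> color) \<Rightarrow> rule \<Rightarrow> bool" where
  "rule_applicable G c r \<longleftrightarrow> (case r of (a, b) \<Rightarrow>
     (\<exists>u v. (u, v) \<in> parcs G \<and> c u = a \<and> c v = b))"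

definition process_terminates ::
    "'v pair_pre_digraph \<Rightarrow> rule list \<Rightarrow> ('v \<Rightarrow> color) \<Rightarrow> bool" where
  "process_terminates G R c \<longleftrightarrow>
     (\<exists>t. \<forall>r \<in> set R. \<not> rule_applicable G (forcing_process G R c t) r)"

end

(* Along a forcing step a vertex can only move from the head of a rule to its tail, so in an
   acyclic network the number of colors from which the color of a given vertex is reachable
   strictly drops whenever that vertex is recolored. At a time minimizing the sum of these numbers
   over all vertices the coloring is therefore frozen, although every rule is still tried later
   on; hence no rule is applicable there. *)

theory Submission
  imports Defs
begin

definition color_rank :: "('a \<times> 'a) set \<Rightarrow> 'a \<Rightarrow> nat" where
  "color_rank S b = card {x. (x, b) \<in> S\<^sup>+}"

text \<open>By transitivity every color counted for \<open>a\<close> is counted for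
  \<open>b\<close>; the color \<open>a\<close> itself is counted only for \<open>b\<close>, as
  acyclicity excludes \<open>(a, a)\<close> from \<open>S\<^sup>+\<close>.\<close>

lemma color_rank_less:
  assumes "finite S" and "acyclic S" and "(a, b) \<in> S"
  shows "color_rank S a < color_rank S b"
  unfolding color_rank_def
proof (rule psubset_card_mono)
  have "{x. (x, b) \<in> S\<^sup>+} \<subseteq> Domain S"
    by (auto dest: tranclD)
  then show "finite {x. (x, b) \<in> S\<^sup>+}"
    using assms(1) by (simp add: finite_subset finite_Domain)
  have "a \<in> {x. (x, b) \<in> S\<^sup>+}" "a \<notin> {x. (x, a) \<in> S\<^sup>+}"
    using assms(2,3) by (auto simp: acyclic_def)
  then show "{x. (x, a) \<in> S\<^sup>+} \<subset> {x. (x, b) \<in> S\<^sup>+}"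
    using assms(3) by (auto intro: trancl_into_trancl)
qed

text \<open>A pair \<open>(u, u)\<close> in the transitive closure yields a nonempty closed walk,
  and such a walk contains a cycle.\<close>

lemma acyclic_network_imp_acyclic:
  assumes "forcing_network N X R" and "acyclic_network X R"
  shows "acyclic (set R)"
proof -
  interpret pair_wf_digraph "network_digraph X R"
    using assms(1) by unfold_locales (auto simp: network_digraph_def forcing_network_def)
  have "\<not> closed_w p" for p
    using assms(2) closed_w_imp_cycle by (auto simp: acyclic_network_def)
  then have "(u, u) \<notin> (parcs (network_digraph X R))\<^sup>+" for u
    by (auto simp: reachable1_awalk closed_w_def)
  then show ?thesis
    by (simp add: acyclic_def network_digraph_def)
qed

lemma forcing_step_change:
  assumes "forcing_step G (a, b) c v \<noteq> c v"
  shows "c v = b" and "forcing_step G (a, b) c v = a" and "v \<in> snd ` parcs G"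
  using assms by (force simp: forcing_step_def split: if_splits)+

text \<open>An applicable rule visibly recolors some vertex, because its two colors differ; a rule
  \<open>(a, a)\<close> would change nothing even where it is applicable.\<close>

lemma forcing_step_eq_imp_not_applicable:
  assumes "forcing_step G r c = c" and "fst r \<noteq> snd r"
  shows "\<not> rule_applicable G c r"
proof
  obtain a b where r: "r = (a, b)"
    by fastforce
  assume "rule_applicable G c r"
  then obtain u v where "(u, v) \<in> parcs G" "c u = a" "c v = b"
    by (auto simp: rule_applicable_def r)
  then have "forcing_step G r c v = a"
    by (auto simp: forcing_step_def r)
  then show False
    using assms \<open>c v = b\<close> by (simp add: r)
qed

lemma forcing_step_sum_rank_less:
  assumes "finite (pverts G)" and "pair_wf_digraph G"
    and "finite S" and "acyclic S" and "r \<in> S"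
    and changed: "forcing_step G r c \<noteq> c"
  shows "(\<Sum>v\<in>pverts G. color_rank S (forcing_step G r c v)) < (\<Sum>v\<in>pverts G. color_rank S (c v))"
proof (rule sum_strict_mono_ex1)
  obtain a b where r: "r = (a, b)"
    by fastforce
  have less: "color_rank S (forcing_step G r c v) < color_rank S (c v)"
    if "forcing_step G r c v \<noteq> c v" for v
    using forcing_step_change(1,2)[OF that[unfolded r]] color_rank_less[OF assms(3,4)] assms(5)
    by (metis r)
  then show "\<forall>v\<in>pverts G. color_rank S (forcing_step G r c v) \<le> color_rank S (c v)"
    by (metis less_imp_le order_refl)
  from changed obtain v where v: "forcing_step G r c v \<noteq> c v"
    by blast
  \<comment> \<open>Colorings are total functions, but only the head of an arc can be recolored, so
    the change is seen by the sum over \<open>pverts G\<close>.\<close>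
  then have "v \<in> pverts G"
    using forcing_step_change(3)[OF v[unfolded r]] pair_wf_digraph.arc_snd_in_verts[OF assms(2)]
    by auto
  with v less show "\<exists>v\<in>pverts G. color_rank S (forcing_step G r c v) < color_rank S (c v)"
    by blast
qed (fact assms(1))

lemma process_terminates_if_acyclic:
  assumes "finite (pverts G)" and "pair_wf_digraph G"
    and "acyclic (set R)"
  shows "process_terminates G R c"
\<comment> \<open>Indexing modulo \<open>length R\<close> is meaningful only for a nonempty
  list.\<close>
proof (cases "R = []")
  case True
  then show ?thesis
    by (simp add: process_terminates_def)
next
  case False
  define P where "P = forcing_process G R c"
  define \<phi> where "\<phi> t = (\<Sum>v\<in>pverts G. color_rank (set R) (P t v))" for t
  obtain T where T: "\<phi> T \<le> \<phi> t" for t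
    using ex_has_least_nat[of "\<lambda>_. True" _ \<phi>] by blast
  have P_Suc: "P (Suc t) = forcing_step G (R ! (t mod length R)) (P t)" for t
    by (simp add: P_def)
  have frozen: "P (T + k) = P T" for k
  proof (induction k)
    case (Suc k)
    have "R ! ((T + k) mod length R) \<in> set R"
      using False by simp
    \<comment> \<open>By induction \<open>\<phi> (T + k)\<close> equals the minimum
      \<open>\<phi> T\<close>, so a further change would push the sum below it.\<close>
    from forcing_step_sum_rank_less[OF assms(1,2) finite_set assms(3) this, of "P (T + k)"]
    have "P (Suc (T + k)) = P (T + k)"
      using T[of "Suc (T + k)"] Suc.IH by (auto simp: \<phi>_def P_Suc)
    with Suc.IH show ?case
      by simp
  qed simp
  have "\<not> rule_applicable G (P T) r" if "r \<in> set R" for r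
  proof (rule forcing_step_eq_imp_not_applicable)
    show "fst r \<noteq> snd r"
      using assms(3) that by (cases r) (auto simp: acyclic_def)
    obtain i where i: "i < length R" "r = R ! i"
      using \<open>r \<in> set R\<close> by (auto simp: in_set_conv_nth)
    \<comment> \<open>Step number \<open>T * length R + i\<close> uses rule \<open>R ! i\<close>,
      and it is not before \<open>T\<close> because \<open>length R\<close> is positive. The
      coloring is frozen there, so this rule fixes \<open>P T\<close>.\<close>
    define k where "k = T * length R + i - T"
    have "T \<le> T * length R"
      using False by (cases R) auto
    then have k: "T + k = T * length R + i"
      unfolding k_def by linarith
    have "P (Suc (T + k)) = forcing_step G r (P (T + k))"
      using i by (simp add: P_Suc k)
    then show "forcing_step G r (P T) = P T"
      using frozen[of k] frozen[of "Suc k"] by simp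
  qed
  then show ?thesis
    unfolding process_terminates_def P_def by blast
qed

theorem theorem3p6:
  fixes N :: nat and X :: "color set" and R :: "rule list"
    and G :: "'v pair_pre_digraph" and c :: "'v \<Rightarrow> color"
  assumes "forcing_network N X R"
    and "acyclic_network X R"
    and "colored_graph X G c"
  shows "process_terminates G R c"
proof -
  interpret pair_graph G
    using assms(3) by (simp add: colored_graph_def)
  show ?thesis
    using pair_finite_verts pair_wf_digraph acyclic_network_imp_acyclic[OF assms(1,2)]
    by (rule process_terminates_if_acyclic)
qed

end
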